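(* Let $p\ge 1$, let $A,B$ be two analytic vector fields on $\mathbb C^p$ with $m(A)<\infty$ and $m(B)<\infty$, and let $D_A,D_B$ be the associated derivations. Write $e^{tD_A}=\sum_{n\in\mathbb N}\frac{t^n}{n!}D_A^n$ for $t\in\mathbb C$. Let $\beta\in\mathbb N^p$. Then: (a) $\epsilon_F(e^{tD_A}(f_\beta^o))$ exists, i.e. the series $\sum_{n\in\mathbb N}\frac{t^n}{n!}\epsilon_F(D_A^n(f_\beta^o))$ converges, for every $t\in\mathbb C$ with $|t|<1/m(A)$. (b) $\epsilon_F(e^{t_2D_B}\circ e^{t_1D_A}(f_\beta^o))$ exists, i.e. the double series $\sum_{n,r\in\mathbb N}\frac{t_2^n}{n!}\frac{t_1^r}{r!}\,\epsilon_F(D_B^n\circ D_A^r(f_\beta^o))$ is summable, for all $t_1,t_2\in\mathbb C$ with $|t_1|\,m(A)+|t_2|\,m(B)<1$.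
   Context: Work over $\mathbb C$. Let $o=(0,\dots,0)\in\mathbb N^p$, and for $1\le i\le p$ let $i(1)\in\mathbb N^p$ be the multi-index with $1$ in position $i$ and $0$ elsewhere. The elements $f_n^o$, $n\in\mathbb N^p$, form the zeroth row of the basis $(f_n^m)_{n,m\in\mathbb N^p}$ of the approximated coalgebra $F_a$, whose counit is $\epsilon_F(f_n^m)=1$ if $n=m$ and $0$ otherwise. An analytic vector field $A$ has components $A^i(z)=\sum_{m\in\mathbb N^p}a_m^iz_1^{m_1}\cdots z_p^{m_p}$ ($1\le i\le p$), power series defining analytic functions, and $m(A)=\sup_{1\le i\le p}\sum_{m\in\mathbb N^p}|a_m^i|$ (with $1/m(A)=+\infty$ if $m(A)=0$). The associated derivation acts on the elements $f_n^o$ by $$D_A(f_n^o)=\sum_{i=1}^p n_i\sum_{m\in\mathbb N^p}a_m^i f_{n+m-i(1)}^o,$$ terms with $n_i=0$ being read as $0$. When infinitely many $a_m^i$ are nonzero, $D_A$ is understood as the operator on formal series $\sum_{n}c_nf_n^o$ given by this formula and extended term by term (each coefficient of the result is a finite sum), and $\epsilon_F(\sum_n c_nf_n^o)=c_o$. *)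

theory Defs
  imports "HOL-Analysis.Analysis"
begin

text \<open>
  The index set of the coordinates is a finite (hence nonempty) type \<open>'p\<close>, so \<open>p = CARD('p) \<ge> 1\<close>.
  Multi-indices are vectors \<open>nat ^ 'p\<close>; the multi-index \<open>o\<close> is \<open>0\<close>, and \<open>i(1)\<close> is \<open>axis i 1\<close>.
  A vector field is given by its coefficients: \<open>A i m\<close> is the coefficient of the monomial with
  exponent \<open>m\<close> in the \<open>i\<close>-th component.
\<close>

type_synonym 'p vfield = "'p \<Rightarrow> nat ^ 'p \<Rightarrow> complex"

definition monomial :: "complex ^ 'p \<Rightarrow> nat ^ 'p::finite \<Rightarrow> complex" where
  "monomial z m = (\<Prod>j\<in>UNIV. (z $ j) ^ (m $ j))"

text \<open>
  Convergence is only required near the origin: a field that is entire on \<open>\<complex>\<^sup>p\<close> automatically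
  has a finite value of \<open>vf_size\<close> below, so finiteness is a genuine condition only for this
  (more general) notion.
\<close>

definition analytic_vfield :: "'p::finite vfield \<Rightarrow> bool" where
  "analytic_vfield A \<longleftrightarrow>
     (\<exists>r>0. \<forall>z :: complex ^ 'p. (\<forall>j. norm (z $ j) < r) \<longrightarrow>
        (\<forall>i. (\<lambda>m. A i m * monomial z m) summable_on UNIV))"

definition vf_size :: "'p::finite vfield \<Rightarrow> ennreal" where
  "vf_size A = (SUP i. \<Sum>\<^sub>\<infinity>m. ennreal (norm (A i m)))"

text \<open>A formal series \<open>\<Sum>\<^sub>n c\<^sub>n f\<^sub>n\<^sup>o\<close> is represented by its coefficient function \<open>c\<close>.\<close>

type_synonym 'p fseries = "nat ^ 'p \<Rightarrow> complex"

definition fbasis :: "nat ^ 'p::finite \<Rightarrow> 'p fseries" where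
  "fbasis n = (\<lambda>k. if k = n then 1 else 0)"

definition counit :: "'p::finite fseries \<Rightarrow> complex" where
  "counit c = c 0"

lemma counit_fbasis: "counit (fbasis n) = (if n = 0 then 1 else 0)"
  by (auto simp: counit_def fbasis_def)

text \<open>
  The coefficient at \<open>k\<close> collects all pairs \<open>(n, m)\<close> such that \<open>f\<^sub>n\<^sup>o\<close> contributes to \<open>f\<^sub>k\<^sup>o\<close>
  through \<open>a\<^sub>m\<^sup>i\<close>; the condition \<open>n $ i > 0\<close> makes the truncated subtraction exact. The index
  set is finite by \<open>finite_contrib\<close>, and \<open>derivation_fbasis\<close> and \<open>derivation_expand\<close> recover the
  action on the basis and its termwise extension.
\<close>

definition contrib :: "'p::finite \<Rightarrow> nat ^ 'p \<Rightarrow> ((nat ^ 'p) \<times> (nat ^ 'p)) set" where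
  "contrib i k = {(n, m). n $ i > 0 \<and> n + m - axis i 1 = k}"

definition derivation :: "'p::finite vfield \<Rightarrow> 'p fseries \<Rightarrow> 'p fseries" where
  "derivation A c = (\<lambda>k. \<Sum>i\<in>UNIV. \<Sum>(n, m)\<in>contrib i k. c n * (of_nat (n $ i) * A i m))"

lemma contrib_iff: "(n, m) \<in> contrib i k \<longleftrightarrow> n $ i > 0 \<and> n + m = k + axis i 1"
proof -
  have "n + m - axis i 1 = k \<longleftrightarrow> n + m = k + axis i 1" if "n $ i > 0"
  proof -
    have "(n $ j + m $ j - axis i 1 $ j = k $ j) \<longleftrightarrow> (n $ j + m $ j = k $ j + axis i 1 $ j)" for j
      using that by (cases "j = i") (auto simp: axis_def)
    then show ?thesis by (simp add: vec_eq_iff)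
  qed
  then show ?thesis by (auto simp: contrib_def)
qed

lemma finite_bounded_multiindices: "finite {n :: nat ^ 'p::finite. \<forall>j. n $ j \<le> b $ j}"
proof -
  have "finite (PiE UNIV (\<lambda>j. {..b $ j}))"
    by (intro finite_PiE) auto
  then have "finite (vec_lambda ` PiE UNIV (\<lambda>j. {..b $ j}))"
    by (rule finite_imageI)
  moreover have "{n :: nat ^ 'p. \<forall>j. n $ j \<le> b $ j} \<subseteq> vec_lambda ` PiE UNIV (\<lambda>j. {..b $ j})"
  proof
    fix n :: "nat ^ 'p" assume "n \<in> {n. \<forall>j. n $ j \<le> b $ j}"
    then have "vec_nth n \<in> PiE UNIV (\<lambda>j. {..b $ j})" by (auto simp: PiE_iff)
    then show "n \<in> vec_lambda ` PiE UNIV (\<lambda>j. {..b $ j})"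
      by (metis imageI vec_nth_inverse)
  qed
  ultimately show ?thesis by (rule rev_finite_subset)
qed

lemma finite_contrib: "finite (contrib i k)"
proof (rule finite_subset)
  let ?S = "{n. \<forall>j. n $ j \<le> (k + axis i 1) $ j}"
  show "contrib i k \<subseteq> ?S \<times> ?S"
  proof (rule subrelI)
    fix n m assume "(n, m) \<in> contrib i k"
    then have "k + axis i 1 = n + m" by (simp add: contrib_iff)
    then show "(n, m) \<in> ?S \<times> ?S" by simp
  qed
  show "finite (?S \<times> ?S)" by (intro finite_cartesian_product finite_bounded_multiindices)
qed

lemma derivation_fbasis:
  "derivation A (fbasis n) k =
     (\<Sum>i\<in>UNIV. of_nat (n $ i) * (\<Sum>\<^sub>\<infinity>m. A i m * fbasis (n + m - axis i 1) k))"
  unfolding derivation_def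
proof (rule sum.cong[OF refl])
  fix i :: 'a
  show "(\<Sum>(n', m)\<in>contrib i k. fbasis n n' * (of_nat (n' $ i) * A i m)) =
        of_nat (n $ i) * (\<Sum>\<^sub>\<infinity>m. A i m * fbasis (n + m - axis i 1) k)"
  proof (cases "n $ i > 0")
    case False
    then have "(\<Sum>(n', m)\<in>contrib i k. fbasis n n' * (of_nat (n' $ i) * A i m)) = 0"
      by (intro sum.neutral) (auto simp: contrib_def fbasis_def)
    then show ?thesis using False by simp
  next
    case True
    define M where "M = {m. n + m - axis i 1 = k}"
    have sub: "Pair n ` M \<subseteq> contrib i k" using True by (auto simp: M_def contrib_def)
    have finM: "finite M"
      using finite_subset[OF sub finite_contrib] by (rule finite_imageD) (auto simp: inj_on_def)
    have "(\<Sum>(n', m)\<in>contrib i k. fbasis n n' * (of_nat (n' $ i) * A i m)) =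
          (\<Sum>(n', m)\<in>Pair n ` M. fbasis n n' * (of_nat (n' $ i) * A i m))"
      by (rule sum.mono_neutral_right[OF finite_contrib sub])
         (auto simp: fbasis_def contrib_def M_def image_iff)
    also have "\<dots> = (\<Sum>m\<in>M. of_nat (n $ i) * A i m)"
      by (subst sum.reindex) (auto simp: inj_on_def fbasis_def)
    also have "\<dots> = of_nat (n $ i) * (\<Sum>\<^sub>\<infinity>m\<in>M. A i m)"
      using finM by (simp add: sum_distrib_left)
    also have "(\<Sum>\<^sub>\<infinity>m\<in>M. A i m) = (\<Sum>\<^sub>\<infinity>m. A i m * fbasis (n + m - axis i 1) k)"
      by (rule infsum_cong_neutral) (auto simp: M_def fbasis_def)
    finally show ?thesis .
  qed
qed

lemma derivation_expand: "derivation A c k = (\<Sum>\<^sub>\<infinity>n. c n * derivation A (fbasis n) k)"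
proof -
  define N where "N = (\<Union>i. fst ` contrib i k)"
  have finN: "finite N" by (auto simp: N_def finite_contrib)
  have zero: "derivation A (fbasis n) k = 0" if "n \<notin> N" for n
    using that unfolding derivation_def
    by (intro sum.neutral ballI) (force simp: N_def fbasis_def intro!: sum.neutral)
  have "(\<Sum>\<^sub>\<infinity>n. c n * derivation A (fbasis n) k) = (\<Sum>\<^sub>\<infinity>n\<in>N. c n * derivation A (fbasis n) k)"
    by (rule infsum_cong_neutral) (auto simp: zero)
  also have "\<dots> = (\<Sum>n\<in>N. c n * derivation A (fbasis n) k)"
    using finN by simp
  also have "\<dots> = (\<Sum>i\<in>UNIV. \<Sum>n\<in>N. \<Sum>(n', m)\<in>contrib i k. c n * (fbasis n n' * (of_nat (n' $ i) * A i m)))"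
    unfolding derivation_def by (subst sum.swap) (simp add: sum_distrib_left case_prod_unfold)
  also have "\<dots> = (\<Sum>i\<in>UNIV. \<Sum>(n', m)\<in>contrib i k. \<Sum>n\<in>N. c n * (fbasis n n' * (of_nat (n' $ i) * A i m)))"
    by (subst sum.swap) (simp add: case_prod_unfold)
  also have "\<dots> = derivation A c k"
    unfolding derivation_def
  proof (intro sum.cong refl, clarify)
    fix i :: 'a and n' m assume "(n', m) \<in> contrib i k"
    then have "n' \<in> N" by (force simp: N_def)
    have "(\<Sum>n\<in>N. c n * (fbasis n n' * (of_nat (n' $ i) * A i m))) =
          (\<Sum>n\<in>N. if n = n' then c n' * (of_nat (n' $ i) * A i m) else 0)"
      by (intro sum.cong refl) (auto simp: fbasis_def)
    then show "(\<Sum>n\<in>N. c n * (fbasis n n' * (of_nat (n' $ i) * A i m))) = c n' * (of_nat (n' $ i) * A i m)"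
      using finN \<open>n' \<in> N\<close> by simp
  qed
  finally show ?thesis ..
qed

end

theory Submission
  imports Defs
begin

text \<open>
  The derivation \<open>D\<^sub>A\<close> is unbounded on formal series, since \<open>f\<^sub>n\<^sup>o\<close> is multiplied by \<open>n\<^sub>i\<close> and
  the degree \<open>|n|\<close> may rise by any amount in one step. But the counit only sees degree \<open>0\<close>, and
  one application of a derivation lowers the degree by at most one. So with \<open>N\<close> derivations still
  to come, only the terms of degree at most \<open>N\<close> matter, and on these the next derivation costs a
  factor of at most \<open>N\<close> times the size of the field.

  This is made precise by the sums \<open>S\<^sub>K(c) = \<Sum>\<^bsub>|k| \<le> K\<^esub> |c\<^sub>k|\<close>, for which
  \<open>S\<^sub>K(D\<^sub>A c) \<le> (K + 1) m(A) S\<^bsub>K+1\<^esub>(c)\<close> (lemma \<open>low_norm_derivation\<close>). Iterating this from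
  \<open>K = 0\<close>, where \<open>S\<^sub>0\<close> is the absolute value of the counit, the factors \<open>1, 2, \<dots>\<close> multiply up to a
  factorial:
  \<open>|\<epsilon>(D\<^sub>B\<^sup>n D\<^sub>A\<^sup>r f\<^sub>\<beta>\<^sup>o)| \<le> (n + r)! m(A)\<^sup>r m(B)\<^sup>n\<close> (lemma \<open>norm_counit_iterates\<close>).
  Against the coefficients \<open>1/n!\<close> and \<open>1/r!\<close> this leaves a binomial coefficient, so the double series
  is dominated, diagonal by diagonal, by the geometric series of ratio \<open>|t\<^sub>1| m(A) + |t\<^sub>2| m(B)\<close>.
  The single series is dominated by the geometric series of ratio \<open>|t| m(A)\<close>.
\<close>

definition mdeg :: "nat ^ 'p::finite \<Rightarrow> nat" where
  "mdeg n = (\<Sum>j\<in>UNIV. n $ j)"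

lemma mdeg_add: "mdeg (n + m) = mdeg n + mdeg m"
  by (simp add: mdeg_def sum.distrib)

lemma mdeg_axis: "mdeg (axis i 1) = 1"
  by (simp add: mdeg_def axis_def)

lemma mdeg_eq_0_iff: "mdeg n = 0 \<longleftrightarrow> n = 0"
  by (simp add: mdeg_def vec_eq_iff)

lemma finite_mdeg_le: "finite {n :: nat ^ 'p::finite. mdeg n \<le> K}"
proof (rule finite_subset)
  show "{n :: nat ^ 'p. mdeg n \<le> K} \<subseteq> {n. \<forall>j. n $ j \<le> (\<chi> j. K) $ j}"
  proof clarsimp
    fix n :: "nat ^ 'p" and j assume "mdeg n \<le> K"
    moreover have "n $ j \<le> mdeg n"
      unfolding mdeg_def by (rule member_le_sum) auto
    ultimately show "n $ j \<le> K" by simp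
  qed
qed (rule finite_bounded_multiindices)

definition low_norm :: "nat \<Rightarrow> 'p::finite fseries \<Rightarrow> real" where
  "low_norm K c = (\<Sum>k | mdeg k \<le> K. norm (c k))"

lemma low_norm_0: "low_norm 0 c = norm (counit c)"
  by (simp add: low_norm_def mdeg_eq_0_iff counit_def)

lemma low_norm_fbasis: "low_norm K (fbasis n) \<le> 1"
proof -
  have "low_norm K (fbasis n) = (\<Sum>k | mdeg k \<le> K. if k = n then 1 else 0)"
    unfolding low_norm_def by (intro sum.cong) (auto simp: fbasis_def)
  then show ?thesis
    by (simp add: finite_mdeg_le)
qed

lemma sum_norm_le_vf_size:
  assumes "vf_size A < \<infinity>" and "finite F"
  shows "(\<Sum>m\<in>F. norm (A i m)) \<le> enn2real (vf_size A)"
proof -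
  have "ennreal (\<Sum>m\<in>F. norm (A i m)) = (\<Sum>m\<in>F. ennreal (norm (A i m)))"
    by simp
  also have "\<dots> \<le> (\<Sum>\<^sub>\<infinity>m. ennreal (norm (A i m)))"
    using \<open>finite F\<close> by (auto simp: nonneg_infsum_complete intro!: SUP_upper)
  also have "\<dots> \<le> vf_size A"
    unfolding vf_size_def by (rule SUP_upper) simp
  finally have "ennreal (\<Sum>m\<in>F. norm (A i m)) \<le> ennreal (enn2real (vf_size A))"
    using assms(1) by simp
  then show ?thesis
    by (simp add: ennreal_le_iff)
qed

text \<open>
  A term of degree at most \<open>K\<close> in \<open>D\<^sub>A c\<close> comes from a term of degree at most \<open>K + 1\<close> in \<open>c\<close>. Each
  pair \<open>(n, m)\<close> feeds only one coefficient for a given \<open>i\<close>, so summing over the pairs gives the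
  factor \<open>\<Sum>\<^sub>i n\<^sub>i m(A) = |n| m(A)\<close> in front of \<open>|c\<^sub>n|\<close>.
\<close>

lemma low_norm_derivation:
  fixes A :: "'p::finite vfield"
  assumes "vf_size A < \<infinity>"
  shows "low_norm K (derivation A c) \<le> real (Suc K) * enn2real (vf_size A) * low_norm (Suc K) c"
proof -
  let ?M = "enn2real (vf_size A)"
  let ?L = "{n :: nat ^ 'p. mdeg n \<le> Suc K}"
  let ?g = "\<lambda>i (n, m). norm (c n) * (real (n $ i) * norm (A i m))"
  have "low_norm K (derivation A c)
      \<le> (\<Sum>k | mdeg k \<le> K. \<Sum>i\<in>UNIV. \<Sum>x\<in>contrib i k. ?g i x)"
    unfolding low_norm_def derivation_def
    by (intro sum_mono order_trans[OF norm_sum] order_trans[OF norm_sum])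
       (auto simp: norm_mult split_beta)
  also have "\<dots> = (\<Sum>i\<in>UNIV. \<Sum>k | mdeg k \<le> K. \<Sum>x\<in>contrib i k. ?g i x)"
    by (rule sum.swap)
  also have "\<dots> = (\<Sum>i\<in>UNIV. \<Sum>x\<in>(\<Union>k\<in>{k. mdeg k \<le> K}. contrib i k). ?g i x)"
    by (intro sum.cong refl sum.UNION_disjoint[symmetric])
       (use finite_mdeg_le finite_contrib in \<open>auto simp: contrib_iff\<close>)
  also have "\<dots> \<le> (\<Sum>i\<in>UNIV. \<Sum>x\<in>?L \<times> ?L. ?g i x)"
  proof (intro sum_mono sum_mono2)
    fix i :: 'p
    have "mdeg n \<le> Suc K \<and> mdeg m \<le> Suc K" if "(n, m) \<in> contrib i k" "mdeg k \<le> K" for n m k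
    proof -
      have "mdeg n + mdeg m = mdeg k + 1"
        using that(1) by (metis contrib_iff mdeg_add mdeg_axis)
      then show ?thesis using that(2) by linarith
    qed
    then show "(\<Union>k\<in>{k. mdeg k \<le> K}. contrib i k) \<subseteq> ?L \<times> ?L"
      by auto
  qed (auto simp: finite_mdeg_le)
  also have "\<dots> = (\<Sum>i\<in>UNIV. \<Sum>n\<in>?L. norm (c n) * real (n $ i) * (\<Sum>m\<in>?L. norm (A i m)))"
    by (simp add: sum.cartesian_product[symmetric] sum_distrib_left mult_ac)
  also have "\<dots> \<le> (\<Sum>i\<in>UNIV. \<Sum>n\<in>?L. norm (c n) * real (n $ i) * ?M)"
    by (intro sum_mono mult_left_mono sum_norm_le_vf_size assms finite_mdeg_le) auto
  also have "\<dots> = (\<Sum>n\<in>?L. real (mdeg n) * (?M * norm (c n)))"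
    by (subst sum.swap) (simp add: mdeg_def sum_distrib_left sum_distrib_right mult_ac)
  also have "\<dots> \<le> (\<Sum>n\<in>?L. real (Suc K) * (?M * norm (c n)))"
    by (intro sum_mono mult_right_mono) (auto simp del: of_nat_Suc)
  also have "\<dots> = real (Suc K) * ?M * low_norm (Suc K) c"
    by (simp add: low_norm_def sum_distrib_left mult_ac)
  finally show ?thesis .
qed

text \<open>
  The constant \<open>(K + 1) \<dots> (K + n) = (K + n)! / K!\<close> is split over the two sides so that estimates
  for successive powers, ending at \<open>K + n\<close> and starting from there, can be chained directly.
\<close>

lemma low_norm_derivation_funpow:
  assumes "vf_size A < \<infinity>"
  shows "fact K * low_norm K ((derivation A ^^ n) c)
    \<le> fact (K + n) * enn2real (vf_size A) ^ n * low_norm (K + n) c"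
proof (induction n arbitrary: K)
  case 0
  show ?case by simp
next
  case (Suc n)
  let ?M = "enn2real (vf_size A)"
  have "fact K * low_norm K ((derivation A ^^ Suc n) c)
      \<le> fact K * (real (Suc K) * ?M * low_norm (Suc K) ((derivation A ^^ n) c))"
    by (intro mult_left_mono) (use low_norm_derivation[OF assms] in auto)
  also have "\<dots> = ?M * (fact (Suc K) * low_norm (Suc K) ((derivation A ^^ n) c))"
    by (simp add: fact_Suc mult_ac)
  also have "\<dots> \<le> ?M * (fact (Suc K + n) * ?M ^ n * low_norm (Suc K + n) c)"
    by (intro mult_left_mono Suc.IH) simp
  finally show ?case by (simp add: mult_ac)
qed

lemma norm_counit_iterates:
  assumes "vf_size A < \<infinity>" and "vf_size B < \<infinity>"
  shows "norm (counit ((derivation B ^^ n) ((derivation A ^^ r) (fbasis \<beta>))))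
    \<le> fact (n + r) * enn2real (vf_size A) ^ r * enn2real (vf_size B) ^ n"
proof -
  let ?a = "enn2real (vf_size A)" and ?b = "enn2real (vf_size B)"
  let ?c = "(derivation A ^^ r) (fbasis \<beta>)"
  have "norm (counit ((derivation B ^^ n) ?c)) \<le> ?b ^ n * (fact n * low_norm n ?c)"
    using low_norm_derivation_funpow[OF assms(2), of 0 n ?c] by (simp add: low_norm_0 mult_ac)
  also have "\<dots> \<le> ?b ^ n * (fact (n + r) * ?a ^ r * low_norm (n + r) (fbasis \<beta>))"
    by (intro mult_left_mono low_norm_derivation_funpow assms) simp
  also have "\<dots> \<le> ?b ^ n * (fact (n + r) * ?a ^ r * 1)"
    by (intro mult_left_mono low_norm_fbasis) auto
  finally show ?thesis by (simp add: mult_ac)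
qed

text \<open>
  On the diagonal \<open>n + r = k\<close> the terms add up to \<open>(x + y)\<^sup>k\<close>, so every finite partial sum is
  bounded by a sum over a large triangle, hence by a geometric series.
\<close>

lemma summable_on_binomial_terms:
  fixes x y :: real
  assumes "x \<ge> 0" "y \<ge> 0" "x + y < 1"
  shows "(\<lambda>(n, r). real ((n + r) choose n) * y ^ n * x ^ r) summable_on UNIV"
proof (rule nonneg_bdd_above_summable_on)
  let ?f = "\<lambda>(n, r). real ((n + r) choose n) * y ^ n * x ^ r"
  show nonneg: "?f p \<ge> 0" for p
    using assms by (auto split: prod.split)
  have "sum ?f F \<le> 1 / (1 - (x + y))" if "finite F" for F
  proof -
    from \<open>finite F\<close> have "finite ((\<lambda>(n, r). n + r) ` F)" by simp
    then obtain N where N: "\<And>n r. (n, r) \<in> F \<Longrightarrow> n + r \<le> N"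
      using finite_nat_set_iff_bounded_le by force
    have "finite {(n, r). n + r \<le> N}"
      by (rule finite_subset[of _ "{..N} \<times> {..N}"]) auto
    then have "sum ?f F \<le> sum ?f {(n, r). n + r \<le> N}"
      using N nonneg by (intro sum_mono2) auto
    also have "\<dots> = (\<Sum>k\<le>N. \<Sum>n\<le>k. real ((n + (k - n)) choose n) * y ^ n * x ^ (k - n))"
      by (rule sum.triangle_reindex_eq)
    also have "\<dots> = (\<Sum>k\<le>N. (x + y) ^ k)"
      by (simp add: binomial_ring add.commute[of x])
    also have "\<dots> \<le> (\<Sum>k. (x + y) ^ k)"
      using assms by (intro sum_le_suminf summable_geometric) auto
    also have "\<dots> = 1 / (1 - (x + y))"
      using assms by (intro suminf_geometric) auto
    finally show ?thesis .
  qed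
  then show "bdd_above (sum ?f ` {F. F \<subseteq> UNIV \<and> finite F})"
    by (auto intro!: bdd_aboveI)
qed

theorem mainTheorem4:
  fixes A B :: "'p::finite vfield" and \<beta> :: "nat ^ 'p"
  assumes "analytic_vfield A" and "analytic_vfield B"
    and "vf_size A < \<infinity>" and "vf_size B < \<infinity>"
  shows
    "(\<forall>t :: complex. ennreal (norm t) < 1 / vf_size A \<longrightarrow>
        summable (\<lambda>n :: nat. t ^ n / fact n * counit ((derivation A ^^ n) (fbasis \<beta>))))
     \<and>
     (\<forall>t1 t2 :: complex. ennreal (norm t1) * vf_size A + ennreal (norm t2) * vf_size B < 1 \<longrightarrow>
        (\<lambda>(n :: nat, r :: nat). t2 ^ n / fact n * (t1 ^ r / fact r) *
            counit (((derivation B ^^ n) \<circ> (derivation A ^^ r)) (fbasis \<beta>))) summable_on UNIV)"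
proof (intro conjI allI impI)
  let ?a = "enn2real (vf_size A)" and ?b = "enn2real (vf_size B)"
  have a: "vf_size A = ennreal ?a" and b: "vf_size B = ennreal ?b"
    using assms(3,4) by simp_all
  {
    fix t :: complex
    assume t: "ennreal (norm t) < 1 / vf_size A"
    have ratio: "norm t * ?a < 1"
    proof (cases "?a = 0")
      case False
      then have "?a > 0"
        by (simp add: order_less_le)
      then have "ennreal (norm t) < ennreal (1 / ?a)"
        using t by (subst (asm) a) (simp add: divide_ennreal flip: ennreal_1)
      then show ?thesis
        using \<open>?a > 0\<close> by (simp add: ennreal_less_iff field_simps)
    qed simp
    show "summable (\<lambda>n. t ^ n / fact n * counit ((derivation A ^^ n) (fbasis \<beta>)))"
    proof (rule summable_comparison_test')
      show "summable (\<lambda>n. (norm t * ?a) ^ n)"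
        using ratio by (intro summable_geometric) simp
      fix n
      have "norm (t ^ n / fact n * counit ((derivation A ^^ n) (fbasis \<beta>)))
          = norm t ^ n / fact n * norm (counit ((derivation A ^^ n) (fbasis \<beta>)))"
        by (simp add: norm_mult norm_divide norm_power)
      also have "\<dots> \<le> norm t ^ n / fact n * (fact n * ?a ^ n)"
        using norm_counit_iterates[OF assms(3,3), of 0 n \<beta>] by (intro mult_left_mono) auto
      finally show "norm (t ^ n / fact n * counit ((derivation A ^^ n) (fbasis \<beta>)))
          \<le> (norm t * ?a) ^ n"
        by (simp add: power_mult_distrib)
    qed
  next
    fix t1 t2 :: complex
    assume t: "ennreal (norm t1) * vf_size A + ennreal (norm t2) * vf_size B < 1"
    let ?x = "norm t1 * ?a" and ?y = "norm t2 * ?b"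
    have "ennreal (?x + ?y) < ennreal 1"
      using t by (subst (asm) a, subst (asm) b)
        (simp add: ennreal_plus ennreal_mult del: ennreal_enn2real_if)
    then have ratio: "?x + ?y < 1"
      by (subst (asm) ennreal_less_iff) auto
    show "(\<lambda>(n, r). t2 ^ n / fact n * (t1 ^ r / fact r) *
        counit (((derivation B ^^ n) \<circ> (derivation A ^^ r)) (fbasis \<beta>))) summable_on UNIV"
    proof (rule abs_summable_summable, rule Infinite_Sum.abs_summable_on_comparison_test')
      show "(\<lambda>(n, r). real ((n + r) choose n) * ?y ^ n * ?x ^ r) summable_on UNIV"
        using ratio by (intro summable_on_binomial_terms) auto
      fix p :: "nat \<times> nat"
      obtain n r where p: "p = (n, r)" by fastforce
      let ?e = "counit (((derivation B ^^ n) \<circ> (derivation A ^^ r)) (fbasis \<beta>))"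
      have "norm (t2 ^ n / fact n * (t1 ^ r / fact r) * ?e)
          = norm t2 ^ n / fact n * (norm t1 ^ r / fact r) * norm ?e"
        by (simp add: norm_mult norm_divide norm_power)
      also have "\<dots> \<le> norm t2 ^ n / fact n * (norm t1 ^ r / fact r)
          * (fact (n + r) * ?a ^ r * ?b ^ n)"
        using norm_counit_iterates[OF assms(3,4)] by (intro mult_left_mono) auto
      also have "\<dots> = real ((n + r) choose n) * ?y ^ n * ?x ^ r"
        by (simp add: binomial_fact power_mult_distrib field_simps)
      finally show "norm (case p of (n, r) \<Rightarrow> t2 ^ n / fact n * (t1 ^ r / fact r) *
            counit (((derivation B ^^ n) \<circ> (derivation A ^^ r)) (fbasis \<beta>)))
          \<le> (case p of (n, r) \<Rightarrow> real ((n + r) choose n) * ?y ^ n * ?x ^ r)"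
        by (simp add: p)
    qed
  }
qed

end
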